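(* Let $P$ be a lattice-ordered algebra of S-probabilities on a set $S$, let $p,q\in P$ and $P_2=\{p,q\}$, and let $\odot$ denote the operation $x\odot y:=x\wedge y$ on $P$. Then the following hold: (i) $P_2$ is Boolean embeddable (into $P$) if and only if $p\odot(1-q)=p-p\odot q$. (ii) If $p$ and $q$ are two-valued and all elements of $P$ are two-valued (i.e. take only the values $0$ and $1$), then $P_2$ is Boolean embeddable (into $P$) if and only if $p\odot q=pq$, where $pq$ is the pointwise product of functions.
   Context: Let $S$ be a set. An S-probability is a function $p\colon S\to[0,1]$. Functions are ordered pointwise by $\leq$; $0,1$ also denote the constant functions; $p':=1-p$; and $p\perp q$ means $p\leq q'$. A set $P$ of S-probabilities is an algebra of S-probabilities if (S1) $0,1\in P$; (S2) $p'\in P$ for every $p\in P$; (S3) if $p,q,r\in P$ satisfy $p\perp q\perp r\perp p$ then $p+q+r\in P$ (pointwise sum). It is lattice-ordered if $(P,\leq)$ is a lattice; $\vee,\wedge$ denote the supremum and infimum in $(P,\leq)$ (not necessarily pointwise maximum/minimum). In this case $(P,\vee,\wedge,{}',0,1)$ is an orthomodular lattice. A subset $T\subseteq P$ is called Boolean embeddable (into $P$) if there is a Boolean subalgebra of $P$ containing $T$, i.e. a subset of $P$ containing $T$, $0$ and $1$, closed under $\vee$, $\wedge$ and $'$, and forming a Boolean algebra under these operations. The operation $\odot$ binds more strongly than $-$; $-$ is pointwise difference of functions. *)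

theory Defs
  imports Complex_Main "HOL-Library.FuncSet" "HOL-Algebra.Lattice"
begin

text \<open>
  A function on \<open>S\<close> is represented by its extensional representative, that is, it is
  \<^const>\<open>undefined\<close> outside \<open>S\<close>.  Hence equality of functions is equality on \<open>S\<close>, the
  pointwise order on \<open>S\<close> is antisymmetric, and \<open>S\<close> may be any set, including the empty one.
\<close>

definition S_probabilities :: "'s set \<Rightarrow> ('s \<Rightarrow> real) set" where
  "S_probabilities S = S \<rightarrow>\<^sub>E {0..1}"

definition fun_le :: "'s set \<Rightarrow> ('s \<Rightarrow> real) \<Rightarrow> ('s \<Rightarrow> real) \<Rightarrow> bool" where
  "fun_le S p q \<longleftrightarrow> (\<forall>s\<in>S. p s \<le> q s)"

definition fun_const :: "'s set \<Rightarrow> real \<Rightarrow> ('s \<Rightarrow> real)" where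
  "fun_const S c = (\<lambda>s\<in>S. c)"

definition fun_add :: "'s set \<Rightarrow> ('s \<Rightarrow> real) \<Rightarrow> ('s \<Rightarrow> real) \<Rightarrow> ('s \<Rightarrow> real)" where
  "fun_add S p q = (\<lambda>s\<in>S. p s + q s)"

definition fun_diff :: "'s set \<Rightarrow> ('s \<Rightarrow> real) \<Rightarrow> ('s \<Rightarrow> real) \<Rightarrow> ('s \<Rightarrow> real)" where
  "fun_diff S p q = (\<lambda>s\<in>S. p s - q s)"

definition fun_mult :: "'s set \<Rightarrow> ('s \<Rightarrow> real) \<Rightarrow> ('s \<Rightarrow> real) \<Rightarrow> ('s \<Rightarrow> real)" where
  "fun_mult S p q = (\<lambda>s\<in>S. p s * q s)"

definition fun_compl :: "'s set \<Rightarrow> ('s \<Rightarrow> real) \<Rightarrow> ('s \<Rightarrow> real)" where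
  "fun_compl S p = fun_diff S (fun_const S 1) p"

definition S_orthogonal :: "'s set \<Rightarrow> ('s \<Rightarrow> real) \<Rightarrow> ('s \<Rightarrow> real) \<Rightarrow> bool" where
  "S_orthogonal S p q \<longleftrightarrow> fun_le S p (fun_compl S q)"

definition two_valued :: "'s set \<Rightarrow> ('s \<Rightarrow> real) \<Rightarrow> bool" where
  "two_valued S p \<longleftrightarrow> (\<forall>s\<in>S. p s \<in> {0, 1})"

definition algebra_of_S_probabilities :: "'s set \<Rightarrow> ('s \<Rightarrow> real) set \<Rightarrow> bool" where
  "algebra_of_S_probabilities S P \<longleftrightarrow>
     P \<subseteq> S_probabilities S \<and>
     fun_const S 0 \<in> P \<and> fun_const S 1 \<in> P \<and>
     (\<forall>p\<in>P. fun_compl S p \<in> P) \<and>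
     (\<forall>p\<in>P. \<forall>q\<in>P. \<forall>r\<in>P.
        S_orthogonal S p q \<and> S_orthogonal S q r \<and> S_orthogonal S r p \<longrightarrow>
        fun_add S (fun_add S p q) r \<in> P)"

definition poset_of :: "'s set \<Rightarrow> ('s \<Rightarrow> real) set \<Rightarrow> ('s \<Rightarrow> real) gorder" where
  "poset_of S P = \<lparr>carrier = P, eq = (=), le = fun_le S\<rparr>"

definition lattice_ordered :: "'s set \<Rightarrow> ('s \<Rightarrow> real) set \<Rightarrow> bool" where
  "lattice_ordered S P \<longleftrightarrow> lattice (poset_of S P)"

text \<open>
  The axioms of the library locale \<^locale>\<open>abstract_boolean_algebra\<close>, relativised to a
  carrier set (the locale itself is about whole types).  The one-element Boolean algebra is
  admitted, as in that locale; it occurs only for empty \<open>S\<close>.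
\<close>

definition boolean_algebra_on ::
  "'a set \<Rightarrow> ('a \<Rightarrow> 'a \<Rightarrow> 'a) \<Rightarrow> ('a \<Rightarrow> 'a \<Rightarrow> 'a) \<Rightarrow> ('a \<Rightarrow> 'a) \<Rightarrow> 'a \<Rightarrow> 'a \<Rightarrow> bool"
where
  "boolean_algebra_on B mt jn neg zero one \<longleftrightarrow>
     zero \<in> B \<and> one \<in> B \<and>
     (\<forall>x\<in>B. neg x \<in> B) \<and>
     (\<forall>x\<in>B. \<forall>y\<in>B. mt x y \<in> B \<and> jn x y \<in> B) \<and>
     (\<forall>x\<in>B. \<forall>y\<in>B. \<forall>z\<in>B. mt (mt x y) z = mt x (mt y z)) \<and>
     (\<forall>x\<in>B. \<forall>y\<in>B. mt x y = mt y x) \<and>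
     (\<forall>x\<in>B. \<forall>y\<in>B. \<forall>z\<in>B. jn (jn x y) z = jn x (jn y z)) \<and>
     (\<forall>x\<in>B. \<forall>y\<in>B. jn x y = jn y x) \<and>
     (\<forall>x\<in>B. \<forall>y\<in>B. \<forall>z\<in>B. mt x (jn y z) = jn (mt x y) (mt x z)) \<and>
     (\<forall>x\<in>B. \<forall>y\<in>B. \<forall>z\<in>B. jn x (mt y z) = mt (jn x y) (jn x z)) \<and>
     (\<forall>x\<in>B. mt x one = x) \<and>
     (\<forall>x\<in>B. jn x zero = x) \<and>
     (\<forall>x\<in>B. mt x (neg x) = zero) \<and>
     (\<forall>x\<in>B. jn x (neg x) = one)"

definition boolean_subalgebra :: "'s set \<Rightarrow> ('s \<Rightarrow> real) set \<Rightarrow> ('s \<Rightarrow> real) set \<Rightarrow> bool" where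
  "boolean_subalgebra S P B \<longleftrightarrow>
     B \<subseteq> P \<and>
     boolean_algebra_on B (meet (poset_of S P)) (join (poset_of S P)) (fun_compl S)
       (fun_const S 0) (fun_const S 1)"

definition boolean_embeddable :: "'s set \<Rightarrow> ('s \<Rightarrow> real) set \<Rightarrow> ('s \<Rightarrow> real) set \<Rightarrow> bool" where
  "boolean_embeddable S P T \<longleftrightarrow> (\<exists>B. boolean_subalgebra S P B \<and> T \<subseteq> B)"

definition odot ::
  "'s set \<Rightarrow> ('s \<Rightarrow> real) set \<Rightarrow> ('s \<Rightarrow> real) \<Rightarrow> ('s \<Rightarrow> real) \<Rightarrow> ('s \<Rightarrow> real)" where
  "odot S P x y = x \<sqinter>\<^bsub>poset_of S P\<^esub> y"

end

theory Submission
  imports Defs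
begin

text \<open>
  By (S3), the sum of two orthogonal elements of \<open>P\<close> is their supremum: if \<open>r\<close> is an upper
  bound of both, then \<open>x\<close>, \<open>y\<close> and \<open>1 - r\<close> are pairwise orthogonal, so \<open>x + y + (1 - r)\<close>
  lies in \<open>P\<close> and is at most \<open>1\<close>.  Hence the condition in (i) says that \<open>p\<close> is the supremum
  of \<open>p \<and> q\<close> and \<open>p \<and> q'\<close>, which holds in any Boolean subalgebra by distributivity.
  Conversely, under this condition the four elements \<open>p \<and> q\<close>, \<open>p \<and> q'\<close>, \<open>q - p \<and> q\<close> and
  \<open>1 - p - (q - p \<and> q)\<close> of \<open>P\<close> sum to \<open>1\<close>, and the sums over subfamilies of a
  family with sum \<open>1\<close> form a Boolean subalgebra.
\<close>

section \<open>Closure properties and suprema in a lattice-ordered algebra of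
  S-probabilities\<close>

locale lattice_S_algebra =
  fixes S :: "'s set" and P :: "('s \<Rightarrow> real) set"
  assumes algebra: "algebra_of_S_probabilities S P"
    and lattice: "lattice_ordered S P"
begin

lemma range_P:
  assumes "x \<in> P" "s \<in> S"
  shows "0 \<le> x s" "x s \<le> 1"
  using assms algebra
  by (auto simp: algebra_of_S_probabilities_def S_probabilities_def PiE_iff subset_eq)

lemma extensional_P: "x \<in> P \<Longrightarrow> x \<in> extensional S"
  using algebra
  by (auto simp: algebra_of_S_probabilities_def S_probabilities_def PiE_iff subset_eq)

lemma zero_closed: "fun_const S 0 \<in> P"
  and compl_closed: "x \<in> P \<Longrightarrow> fun_compl S x \<in> P"
  using algebra by (auto simp: algebra_of_S_probabilities_def)

lemma compl_apply: "s \<in> S \<Longrightarrow> fun_compl S x s = 1 - x s"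
  by (simp add: fun_compl_def fun_diff_def fun_const_def)

lemma add3_closed:
  assumes "x \<in> P" "y \<in> P" "z \<in> P"
    and "\<And>s. s \<in> S \<Longrightarrow> x s + y s \<le> 1"
    and "\<And>s. s \<in> S \<Longrightarrow> y s + z s \<le> 1"
    and "\<And>s. s \<in> S \<Longrightarrow> z s + x s \<le> 1"
  shows "(\<lambda>s\<in>S. x s + y s + z s) \<in> P"
proof -
  have "S_orthogonal S x y" "S_orthogonal S y z" "S_orthogonal S z x"
    using assms(4-) by (auto simp: S_orthogonal_def fun_le_def compl_apply le_diff_eq)
  then have "fun_add S (fun_add S x y) z \<in> P"
    using algebra assms(1-3) unfolding algebra_of_S_probabilities_def by blast
  moreover have "fun_add S (fun_add S x y) z = (\<lambda>s\<in>S. x s + y s + z s)"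
    by (auto simp: fun_add_def)
  ultimately show ?thesis by simp
qed

text \<open>Every element is orthogonal to the constant 0, so taking 0 as third summand turns (S3)
  into a statement about two summands.\<close>

lemma add_closed:
  assumes "x \<in> P" "y \<in> P" "\<And>s. s \<in> S \<Longrightarrow> x s + y s \<le> 1"
  shows "fun_add S x y \<in> P"
proof -
  have "(\<lambda>s\<in>S. x s + y s + fun_const S 0 s) \<in> P"
    using assms by (intro add3_closed zero_closed) (auto simp: fun_const_def range_P)
  moreover have "(\<lambda>s\<in>S. x s + y s + fun_const S 0 s) = fun_add S x y"
    by (auto simp: fun_const_def fun_add_def)
  ultimately show ?thesis by simp
qed

text \<open>By double complement, \<open>y - x\<close> is \<open>1 - (x + (1 - y))\<close>, and the
  inner sum is one of orthogonal elements because \<open>x\<close> lies below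
  \<open>y\<close>.\<close>

lemma diff_closed:
  assumes "x \<in> P" "y \<in> P" "fun_le S x y"
  shows "fun_diff S y x \<in> P"
proof -
  have "fun_compl S (fun_add S x (fun_compl S y)) \<in> P"
    using assms by (intro compl_closed add_closed) (auto simp: compl_apply fun_le_def)
  moreover have "fun_compl S (fun_add S x (fun_compl S y)) = fun_diff S y x"
    by (auto simp: fun_compl_def fun_diff_def fun_const_def fun_add_def)
  ultimately show ?thesis by simp
qed

lemma add_least:
  assumes "x \<in> P" "y \<in> P" "r \<in> P" "fun_le S x r" "fun_le S y r"
    and "\<And>s. s \<in> S \<Longrightarrow> x s + y s \<le> 1"
  shows "fun_le S (fun_add S x y) r"
proof -
  have *: "(\<lambda>s\<in>S. x s + y s + fun_compl S r s) \<in> P"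
    using assms
    by (intro add3_closed compl_closed) (auto simp: compl_apply fun_le_def)
  show ?thesis
    using range_P(2)[OF *] by (auto simp: fun_le_def fun_add_def compl_apply algebra_simps)
qed

sublocale order: Lattice.lattice "poset_of S P"
  rewrites "carrier (poset_of S P) = P"
    and "le (poset_of S P) = fun_le S"
  using lattice by (simp_all add: lattice_ordered_def poset_of_def)

lemma fun_le_antisym:
  assumes "x \<in> P" "y \<in> P" "fun_le S x y" "fun_le S y x"
  shows "x = y"
  using assms by (intro extensionalityI[of _ S]) (auto simp: extensional_P fun_le_def intro: antisym)

text \<open>\<open>meet\<close> is a chosen greatest lower bound; antisymmetry on extensional
  functions makes it the only one, so it can be computed by exhibiting a candidate.\<close>

lemma meet_eqI:
  assumes "x \<in> P" "y \<in> P" "z \<in> P" "fun_le S z x" "fun_le S z y"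
    and "\<And>r. r \<in> P \<Longrightarrow> fun_le S r x \<Longrightarrow> fun_le S r y \<Longrightarrow> fun_le S r z"
  shows "meet (poset_of S P) x y = z"
  using assms
  by (intro fun_le_antisym order.meet_closed order.meet_le) (auto simp: order.meet_left order.meet_right)

lemma join_eqI:
  assumes "x \<in> P" "y \<in> P" "z \<in> P" "fun_le S x z" "fun_le S y z"
    and "\<And>r. r \<in> P \<Longrightarrow> fun_le S x r \<Longrightarrow> fun_le S y r \<Longrightarrow> fun_le S z r"
  shows "join (poset_of S P) x y = z"
  using assms
  by (intro fun_le_antisym order.join_closed order.join_le) (auto simp: order.join_left order.join_right)

lemma join_orthogonal:
  assumes "x \<in> P" "y \<in> P" "\<And>s. s \<in> S \<Longrightarrow> x s + y s \<le> 1"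
  shows "join (poset_of S P) x y = fun_add S x y"
  using assms
  by (intro join_eqI add_closed add_least) (auto simp: fun_le_def fun_add_def range_P)

end

section \<open>Finite families with sum 1 and their subset sums\<close>

definition subset_sum :: "'s set \<Rightarrow> ('i \<Rightarrow> 's \<Rightarrow> real) \<Rightarrow> 'i set \<Rightarrow> 's \<Rightarrow> real" where
  "subset_sum S a A = (\<lambda>s\<in>S. \<Sum>i\<in>A. a i s)"

text \<open>A partition of unity in \<open>P\<close>: values are nonnegative and sum to 1, so
  members with distinct indices are orthogonal. Members may vanish, so distinct index sets may have
  the same sum.\<close>

locale S_partition = lattice_S_algebra S P
  for S :: "'s set" and P +
  fixes a :: "'i::finite \<Rightarrow> 's \<Rightarrow> real"
  assumes a_closed: "a i \<in> P"
    and sum_a: "s \<in> S \<Longrightarrow> (\<Sum>i\<in>UNIV. a i s) = 1"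
begin

lemma subset_sum_apply: "s \<in> S \<Longrightarrow> subset_sum S a A s = (\<Sum>i\<in>A. a i s)"
  by (simp add: subset_sum_def)

lemma subset_sum_mono:
  assumes "A \<subseteq> B"
  shows "fun_le S (subset_sum S a A) (subset_sum S a B)"
  using assms by (auto simp: fun_le_def subset_sum_apply a_closed range_P intro!: sum_mono2)

lemma subset_sum_le_1: "s \<in> S \<Longrightarrow> (\<Sum>i\<in>A. a i s) \<le> 1"
  using sum_mono2[of UNIV A "\<lambda>i. a i s"] by (simp add: sum_a a_closed range_P)

lemma subset_sum_UNIV: "subset_sum S a UNIV = fun_const S 1"
  by (auto simp: subset_sum_def fun_const_def sum_a)

lemma subset_sum_empty: "subset_sum S a {} = fun_const S 0"
  by (auto simp: subset_sum_def fun_const_def)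

lemma subset_sum_Compl: "subset_sum S a (- A) = fun_compl S (subset_sum S a A)"
proof (rule extensionalityI[of _ S])
  fix s assume s: "s \<in> S"
  have "(\<Sum>i\<in>A. a i s) + (\<Sum>i\<in>-A. a i s) = (\<Sum>i\<in>UNIV. a i s)"
    using sum.union_disjoint[of A "-A" "\<lambda>i. a i s"] by simp
  then show "subset_sum S a (- A) s = fun_compl S (subset_sum S a A) s"
    using s by (simp add: subset_sum_apply compl_apply sum_a)
qed (auto simp: subset_sum_def fun_compl_def fun_diff_def)

lemma subset_sum_insert:
  assumes "i \<notin> A"
  shows "subset_sum S a (insert i A) = fun_add S (a i) (subset_sum S a A)"
  using assms by (auto simp: subset_sum_def fun_add_def)

lemma add_subset_sum_le_1:
  assumes "i \<notin> A" "s \<in> S"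
  shows "a i s + subset_sum S a A s \<le> 1"
  using assms subset_sum_le_1[of s "insert i A"] by (simp add: subset_sum_apply)

text \<open>Members are added one at a time; each is orthogonal to the sum of the others already
  taken, since the total is at most 1.\<close>

lemma subset_sum_closed: "subset_sum S a A \<in> P"
proof (induction rule: finite_induct[OF finite[of A]])
  case 1
  then show ?case by (simp add: subset_sum_empty zero_closed)
next
  case (2 i A)
  then show ?case
    by (simp add: subset_sum_insert add_closed a_closed add_subset_sum_le_1)
qed

text \<open>Iterating \<open>add_least\<close> makes a subset sum the supremum in \<open>P\<close>
  of its members, not merely their sum.\<close>

lemma subset_sum_least:
  assumes "r \<in> P" "\<And>i. i \<in> A \<Longrightarrow> fun_le S (a i) r"
  shows "fun_le S (subset_sum S a A) r"
  using finite[of A] assms(2)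
proof (induction rule: finite_induct)
  case empty
  then show ?case by (simp add: fun_le_def subset_sum_apply range_P assms(1))
next
  case (insert i A)
  then have "fun_le S (fun_add S (a i) (subset_sum S a A)) r"
    by (intro add_least a_closed subset_sum_closed assms(1)) (simp_all add: add_subset_sum_le_1)
  then show ?case
    using insert.hyps by (simp add: subset_sum_insert)
qed

lemma le_of_subset_sum_le:
  assumes "i \<in> A" "fun_le S (subset_sum S a A) r"
  shows "fun_le S (a i) r"
proof -
  have "a i s \<le> subset_sum S a A s" if "s \<in> S" for s
    using that assms(1) member_le_sum[of i A "\<lambda>i. a i s"]
    by (simp add: subset_sum_apply a_closed range_P)
  then show ?thesis using assms(2) by (force simp: fun_le_def)
qed

text \<open>\<open>A\<close> and \<open>B\<close> may overlap, so the two sums need not be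
  orthogonal. Passing to the single members, which lie below \<open>r\<close>, avoids this.\<close>

lemma subset_sum_Un_least:
  assumes "r \<in> P" "fun_le S (subset_sum S a A) r" "fun_le S (subset_sum S a B) r"
  shows "fun_le S (subset_sum S a (A \<union> B)) r"
  using assms by (blast intro: subset_sum_least le_of_subset_sum_le)

lemma join_subset_sum:
  "join (poset_of S P) (subset_sum S a A) (subset_sum S a B) = subset_sum S a (A \<union> B)"
  by (intro join_eqI subset_sum_closed subset_sum_mono subset_sum_Un_least) auto

lemma fun_le_compl_swap: "fun_le S x (fun_compl S y) \<longleftrightarrow> fun_le S y (fun_compl S x)"
  by (auto simp: fun_le_def compl_apply)

lemma meet_subset_sum:
  "meet (poset_of S P) (subset_sum S a A) (subset_sum S a B) = subset_sum S a (A \<inter> B)"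
proof (intro meet_eqI subset_sum_closed subset_sum_mono)
  fix r assume r: "r \<in> P" "fun_le S r (subset_sum S a A)" "fun_le S r (subset_sum S a B)"
  \<comment> \<open>De Morgan: complementation turns lower bounds of sums over \<open>A\<close> and
    \<open>B\<close> into upper bounds of the sums over \<open>- A\<close> and \<open>- B\<close>,
    which reduces the meet to the case of a union.\<close>
  have *: "fun_le S r (subset_sum S a C) \<longleftrightarrow> fun_le S (subset_sum S a (- C)) (fun_compl S r)" for C
    using fun_le_compl_swap[of r "subset_sum S a (- C)"] by (simp flip: subset_sum_Compl)
  show "fun_le S r (subset_sum S a (A \<inter> B))"
    using r subset_sum_Un_least[of "fun_compl S r" "- A" "- B"]
    by (simp add: * compl_closed)
qed auto

text \<open>\<open>subset_sum S a\<close> carries union, intersection and complement of index sets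
  to join, meet and complement in \<open>P\<close>, so each Boolean law is the image of a set
  identity.\<close>

lemma boolean_subalgebra_subset_sums: "boolean_subalgebra S P (range (subset_sum S a))"
  unfolding boolean_subalgebra_def boolean_algebra_on_def
  by (auto simp: subset_sum_closed meet_subset_sum join_subset_sum
      simp flip: subset_sum_empty subset_sum_UNIV subset_sum_Compl
      intro!: arg_cong[of _ _ "subset_sum S a"])

end

section \<open>Boolean embeddability of a pair\<close>

context lattice_S_algebra
begin

lemma boolean_embeddable_imp_decomposition:
  assumes "boolean_embeddable S P {p, q}" and s: "s \<in> S"
  shows "p s = odot S P p q s + odot S P p (fun_compl S q) s"
proof -
  obtain B where "boolean_subalgebra S P B" and pq: "p \<in> B" "q \<in> B"
    using assms(1) by (auto simp: boolean_embeddable_def)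
  then have B: "B \<subseteq> P" and alg: "boolean_algebra_on B (meet (poset_of S P))
      (join (poset_of S P)) (fun_compl S) (fun_const S 0) (fun_const S 1)"
    by (auto simp: boolean_subalgebra_def)
  have P: "p \<in> P" "q \<in> P" "fun_compl S q \<in> P"
    using pq B by (auto simp: compl_closed)
  have neg: "\<forall>x\<in>B. fun_compl S x \<in> B"
    and meet_one: "\<forall>x\<in>B. meet (poset_of S P) x (fun_const S 1) = x"
    and join_neg: "\<forall>x\<in>B. join (poset_of S P) x (fun_compl S x) = fun_const S 1"
    and distrib: "\<forall>x\<in>B. \<forall>y\<in>B. \<forall>z\<in>B. meet (poset_of S P) x (join (poset_of S P) y z) =
      join (poset_of S P) (meet (poset_of S P) x y) (meet (poset_of S P) x z)"
    using alg unfolding boolean_algebra_on_def by - (elim conjE, assumption)+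
  have "p = meet (poset_of S P) p (join (poset_of S P) q (fun_compl S q))"
    using meet_one join_neg pq by simp
  also have "\<dots> = join (poset_of S P) (odot S P p q) (odot S P p (fun_compl S q))"
    using distrib neg pq by (simp add: odot_def)
  \<comment> \<open>The two meets lie below \<open>q\<close> and its complement respectively, so
    they are orthogonal and their join is their sum.\<close>
  also have "\<dots> = fun_add S (odot S P p q) (odot S P p (fun_compl S q))"
    unfolding odot_def
  proof (intro join_orthogonal order.meet_closed P)
    fix s assume "s \<in> S"
    then show "meet (poset_of S P) p q s + meet (poset_of S P) p (fun_compl S q) s \<le> 1"
      using order.meet_right[OF P(1,2)] order.meet_right[OF P(1,3)] by (force simp: fun_le_def compl_apply)
  qed
  finally have "p s = fun_add S (odot S P p q) (odot S P p (fun_compl S q)) s"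
    by (rule arg_cong)
  then show ?thesis using s by (simp add: fun_add_def)
qed

lemma decomposition_imp_boolean_embeddable:
  assumes P: "p \<in> P" "q \<in> P"
    and decomp: "\<And>s. s \<in> S \<Longrightarrow> p s = odot S P p q s + odot S P p (fun_compl S q) s"
  shows "boolean_embeddable S P {p, q}"
proof -
  define m where "m = odot S P p q"
  define n where "n = odot S P p (fun_compl S q)"
  \<comment> \<open>In a Boolean subalgebra containing \<open>p\<close> and \<open>q\<close>,
    \<open>k\<close> would be the meet of \<open>q\<close> with the complement of \<open>p\<close>,
    and \<open>l\<close> the meet of both complements. Defining them by differences puts them in
    \<open>P\<close> without knowing any distributive law.\<close>
  define k where "k = fun_diff S q m"
  define l where "l = fun_compl S (fun_add S p k)"
  have m: "m \<in> P" "fun_le S m q"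
    using P by (simp_all add: m_def odot_def order.meet_right)
  have n: "n \<in> P" "fun_le S n (fun_compl S q)"
    using P by (simp_all add: n_def odot_def order.meet_right compl_closed)
  have p: "p s = m s + n s" if "s \<in> S" for s
    using decomp[OF that] by (simp add: m_def n_def)
  have k: "k \<in> P"
    unfolding k_def using P m by (intro diff_closed)
  \<comment> \<open>Since \<open>p = m + n\<close> and \<open>k = q - m\<close>, the sum is
    \<open>n + q\<close>, and \<open>n\<close> lies below the complement of
    \<open>q\<close>.\<close>
  have "p s + k s \<le> 1" if "s \<in> S" for s
    using that p[OF that] n(2) by (simp add: k_def fun_diff_def fun_le_def compl_apply le_diff_eq)
  then have l: "l \<in> P"
    unfolding l_def using P k by (intro compl_closed add_closed)
  \<comment> \<open>The index pair records whether a cell belongs to \<open>p\<close> and whether it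
    belongs to \<open>q\<close>, so each of these is the sum of the two cells marked
    \<open>True\<close> in its coordinate.\<close>
  define a where "a = (\<lambda>(i, j). if i then if j then m else n else if j then k else l)"
  have UNIV_eq: "(UNIV :: (bool \<times> bool) set) = {(True, True), (True, False), (False, True), (False, False)}"
    by (auto simp: UNIV_bool UNIV_Times_UNIV[symmetric] simp del: UNIV_Times_UNIV)
  interpret S_partition S P a
  proof
    show "a i \<in> P" for i
      using m n k l by (auto simp: a_def split: prod.splits)
    show "(\<Sum>i\<in>UNIV. a i s) = 1" if "s \<in> S" for s
      using that p[OF that] by (simp add: UNIV_eq a_def l_def compl_apply fun_add_def)
  qed
  have "p = subset_sum S a {(True, True), (True, False)}"
    using P by (intro extensionalityI[of _ S])
      (auto simp: extensional_P subset_sum_def a_def p)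
  moreover have "q = subset_sum S a {(True, True), (False, True)}"
    using P by (intro extensionalityI[of _ S])
      (auto simp: extensional_P subset_sum_def a_def k_def fun_diff_def)
  ultimately have "{p, q} \<subseteq> range (subset_sum S a)" by blast
  then show ?thesis
    using boolean_subalgebra_subset_sums unfolding boolean_embeddable_def by blast
qed

lemma boolean_embeddable_iff:
  assumes "p \<in> P" "q \<in> P"
  shows "boolean_embeddable S P {p, q} \<longleftrightarrow>
    (\<forall>s\<in>S. p s = odot S P p q s + odot S P p (fun_compl S q) s)"
  using boolean_embeddable_imp_decomposition decomposition_imp_boolean_embeddable[OF assms]
  by blast

lemma boolean_embeddable_iff_diff:
  assumes P: "p \<in> P" "q \<in> P"
  shows "boolean_embeddable S P {p, q} \<longleftrightarrow>
    odot S P p (fun_compl S q) = fun_diff S p (odot S P p q)"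
proof -
  have "odot S P p (fun_compl S q) \<in> extensional S"
    using P by (simp add: odot_def order.meet_closed compl_closed extensional_P)
  then have "odot S P p (fun_compl S q) = fun_diff S p (odot S P p q) \<longleftrightarrow>
      (\<forall>s\<in>S. odot S P p (fun_compl S q) s = p s - odot S P p q s)"
    by (auto simp: fun_diff_def intro: extensionalityI[of _ S])
  then show ?thesis
    unfolding boolean_embeddable_iff[OF P] by (force simp: algebra_simps)
qed

text \<open>For two-valued functions the product is the pointwise minimum. The condition thus says
  that the infimum of \<open>p\<close> and \<open>q\<close> in \<open>P\<close> is the pointwise
  one.\<close>

lemma boolean_embeddable_iff_mult:
  assumes P: "p \<in> P" "q \<in> P" and two: "two_valued S p" "two_valued S q"
  shows "boolean_embeddable S P {p, q} \<longleftrightarrow> odot S P p q = fun_mult S p q"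
proof
  define m where "m = odot S P p q"
  define n where "n = odot S P p (fun_compl S q)"
  have m: "m \<in> P" "fun_le S m p" "fun_le S m q"
    using P by (simp_all add: m_def odot_def order.meet_left order.meet_right)
  have n: "n \<in> P" "fun_le S n (fun_compl S q)"
    using P by (simp_all add: n_def odot_def order.meet_right compl_closed)
  {
    assume emb: "boolean_embeddable S P {p, q}"
    have "m s = p s * q s" if s: "s \<in> S" for s
    proof -
      have "p s = m s + n s"
        using emb s by (simp add: boolean_embeddable_iff[OF P] m_def n_def)
      \<comment> \<open>If \<open>q s\<close> is 0, the bounds force \<open>m s = 0\<close>; if it
        is 1, they force \<open>n s = 0\<close>, hence \<open>m s = p s\<close>.\<close>
      moreover have "0 \<le> m s" "0 \<le> n s" "m s \<le> q s" "n s \<le> 1 - q s" "q s \<in> {0, 1}"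
        using s m n two by (auto simp: range_P fun_le_def compl_apply two_valued_def)
      ultimately show ?thesis by auto
    qed
    then show "odot S P p q = fun_mult S p q"
      using m(1) unfolding m_def
      by (intro extensionalityI[of _ S]) (auto simp: extensional_P fun_mult_def)
  }
  {
    assume mult: "odot S P p q = fun_mult S p q"
    have d: "fun_diff S p m s = p s * (1 - q s)" if "s \<in> S" for s
      using that mult by (simp add: m_def fun_diff_def fun_mult_def algebra_simps)
    \<comment> \<open>The difference \<open>p - m\<close> is \<open>p * (1 - q)\<close>, the
      pointwise minimum of \<open>p\<close> and the complement of \<open>q\<close>. It belongs to
      \<open>P\<close> because \<open>m\<close> lies below \<open>p\<close>, so it is also the
      infimum in \<open>P\<close>.\<close>
    have "odot S P p (fun_compl S q) = fun_diff S p m"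
      unfolding odot_def
    proof (intro meet_eqI P compl_closed diff_closed m)
      show "fun_le S (fun_diff S p m) p" "fun_le S (fun_diff S p m) (fun_compl S q)"
        using two by (force simp: fun_le_def d compl_apply two_valued_def)+
    next
      fix r assume "r \<in> P" "fun_le S r p" "fun_le S r (fun_compl S q)"
      then show "fun_le S r (fun_diff S p m)"
        using two by (force simp: fun_le_def d compl_apply two_valued_def)
    qed
    then show "boolean_embeddable S P {p, q}"
      by (simp add: boolean_embeddable_iff_diff[OF P] m_def)
  }
qed

end

theorem theorem4p3:
  fixes S :: "'s set" and P P2 :: "('s \<Rightarrow> real) set" and p q :: "'s \<Rightarrow> real"
  assumes "algebra_of_S_probabilities S P"
    and "lattice_ordered S P"
    and "p \<in> P" and "q \<in> P"
    and "P2 = {p, q}"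
  shows "(boolean_embeddable S P P2 \<longleftrightarrow>
            odot S P p (fun_diff S (fun_const S 1) q) = fun_diff S p (odot S P p q))
       \<and> (two_valued S p \<and> two_valued S q \<and> (\<forall>x\<in>P. two_valued S x) \<longrightarrow>
            (boolean_embeddable S P P2 \<longleftrightarrow> odot S P p q = fun_mult S p q))"
proof -
  interpret lattice_S_algebra S P
    using assms by unfold_locales
  show ?thesis
    using boolean_embeddable_iff_diff boolean_embeddable_iff_mult assms(3-5)
    by (simp add: fun_compl_def)
qed

end
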